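(* Let $N\ge 3$, let $q$ be a prime power, let $D\ge1$ be a real constant (independent of $q$), and let $w\ge1$, $U_w\ge1$ be integers. Suppose that at least one of the following two conditions holds: $$U_w\ge \Phi_{w,q}(D),\qquad \Upsilon_{w,q}(D)\ge U_w.$$ Then for any cap $\mathcal{K}_w\in\mathbf{S}(U_w)$ there exists a point $A_{w+1}$ not covered by $\mathcal{K}_w$ such that $$\Delta_w(A_{w+1})\ge \frac{(w(q-1)+1)\,U_w}{D\,\theta_{N,q}}.$$
   Context: $\mathrm{PG}(N,q)$ is the $N$-dimensional projective space over $\mathbb{F}_q$, and $\theta_{n,q}=\frac{q^{n+1}-1}{q-1}$. A $w$-cap is a set of $w$ points no three of which are collinear. A point is covered by a cap $\mathcal{K}$ if it belongs to $\mathcal{K}$ or lies on a line meeting $\mathcal{K}$ in two points; $\mathcal{U}(\mathcal{K})$ is the set of points of $\mathrm{PG}(N,q)$ not covered by $\mathcal{K}$. $\mathbf{S}(U_w)$ is the set of all $w$-caps $\mathcal{K}_w$ in $\mathrm{PG}(N,q)$ with $\#\mathcal{U}(\mathcal{K}_w)=U_w$. For $A_{w+1}\in\mathcal{U}(\mathcal{K}_w)$, $$\Delta_w(A_{w+1})=\#\mathcal{U}(\mathcal{K}_w)-\#\mathcal{U}(\mathcal{K}_w\cup\{A_{w+1}\}).$$ Moreover, $$\Phi_{w,q}(D)=\frac{D(w-1)\theta_{N,q}(\theta_{N-1,q}+1-w)}{Dw\theta_{N,q}-(\theta_{N-1,q}+1-w)(w(q-1)+1)},\qquad \Upsilon_{w,q}(D)=\frac{D\theta_{N,q}}{w(q-1)+1}.$$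 *)

theory Defs
  imports "HOL-Analysis.Analysis" "HOL-Number_Theory.Prime_Powers"
begin

text \<open>
  \<open>PG(N,q)\<close> is modelled on the vector space \<open>'k ^ 'n\<close>, where \<open>'k\<close> is a finite field with
  \<open>q\<close> elements and \<open>CARD('n) = N + 1\<close>: its points and lines are the linear subspaces
  of (vector space) dimension 1 and 2, and incidence is inclusion of subspaces.
\<close>

definition pg_points :: "('k::field ^ 'n) set set" where
  "pg_points = {P. vec.subspace P \<and> vec.dim P = 1}"

definition pg_lines :: "('k::field ^ 'n) set set" where
  "pg_lines = {L. vec.subspace L \<and> vec.dim L = 2}"

definition pg_collinear ::
    "('k::field ^ 'n) set \<Rightarrow> ('k ^ 'n) set \<Rightarrow> ('k ^ 'n) set \<Rightarrow> bool" where
  "pg_collinear P Q R \<longleftrightarrow> (\<exists>L\<in>pg_lines. P \<subseteq> L \<and> Q \<subseteq> L \<and> R \<subseteq> L)"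

definition is_cap :: "nat \<Rightarrow> ('k::field ^ 'n) set set \<Rightarrow> bool" where
  "is_cap w K \<longleftrightarrow> K \<subseteq> pg_points \<and> finite K \<and> card K = w \<and>
     (\<forall>P\<in>K. \<forall>Q\<in>K. \<forall>R\<in>K. P \<noteq> Q \<and> P \<noteq> R \<and> Q \<noteq> R \<longrightarrow> \<not> pg_collinear P Q R)"

definition covered :: "('k::field ^ 'n) set set \<Rightarrow> ('k ^ 'n) set \<Rightarrow> bool" where
  "covered K P \<longleftrightarrow> P \<in> K \<or> (\<exists>L\<in>pg_lines. P \<subseteq> L \<and> card {Q \<in> K. Q \<subseteq> L} = 2)"

definition uncovered :: "('k::field ^ 'n) set set \<Rightarrow> ('k ^ 'n) set set" where
  "uncovered K = {P \<in> pg_points. \<not> covered K P}"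

definition caps_with_uncovered :: "nat \<Rightarrow> nat \<Rightarrow> ('k::field ^ 'n) set set set" where
  "caps_with_uncovered w U = {K. is_cap w K \<and> card (uncovered K) = U}"

definition newly_covered :: "('k::field ^ 'n) set set \<Rightarrow> ('k ^ 'n) set \<Rightarrow> int" where
  "newly_covered K A = int (card (uncovered K)) - int (card (uncovered (K \<union> {A})))"

definition theta :: "nat \<Rightarrow> nat \<Rightarrow> real" where
  "theta n q = (real q ^ (n + 1) - 1) / (real q - 1)"

definition Phi :: "nat \<Rightarrow> nat \<Rightarrow> nat \<Rightarrow> real \<Rightarrow> real" where
  "Phi N w q D =
     (D * (real w - 1) * theta N q * (theta (N - 1) q + 1 - real w)) /
     (D * real w * theta N q
       - (theta (N - 1) q + 1 - real w) * (real w * (real q - 1) + 1))"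

definition Upsilon :: "nat \<Rightarrow> nat \<Rightarrow> nat \<Rightarrow> real \<Rightarrow> real" where
  "Upsilon N w q D = (D * theta N q) / (real w * (real q - 1) + 1)"

end

theory Submission
  imports Defs
begin

text \<open>
  An uncovered point \<open>A\<close> sees the points of \<open>K\<close> along pairwise different tangents, and joining
  \<open>A\<close> to \<open>K\<close> covers \<open>A\<close> together with all uncovered points on these tangents. If \<open>U\<close> is small,
  covering \<open>A\<close> alone is enough. If \<open>U\<close> is large, average over \<open>A\<close>: through each point of \<open>K\<close>
  there are at most \<open>\<theta>\<^sub>N\<^sub>-\<^sub>1 + 1 - w\<close> tangents, so by Cauchy--Schwarz the average of
  \<open>newly_covered K A\<close> is at least \<open>w U / (\<theta>\<^sub>N\<^sub>-\<^sub>1 + 1 - w) - (w - 1)\<close>.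
\<close>

section \<open>Counting vectors in subspaces over a finite field\<close>

lemma card_span_independent:
  fixes B :: "('k::{field,finite} ^ 'n) set"
  assumes "vec.independent B"
  shows "card (vec.span B) = CARD('k) ^ card B"
proof -
  have "finite B" by simp
  then show ?thesis using assms
  proof (induction B)
    case empty
    then show ?case by simp
  next
    case (insert b B)
    have ind: "vec.independent B" and b: "b \<notin> vec.span B"
      using insert.prems insert.hyps by (simp_all add: vec.independent_insert)
    let ?f = "\<lambda>(c::'k, x). c *s b + x"
    \<comment> \<open>Splitting off the coefficient of \<open>b\<close> is unique because
      \<open>b\<close> lies outside the span of \<open>B\<close>. Each new basis vector therefore
      multiplies the number of vectors by \<open>CARD('k)\<close>.\<close>
    have "bij_betw ?f (UNIV \<times> vec.span B) (vec.span (insert b B))"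
      unfolding bij_betw_def
    proof
      show "inj_on ?f (UNIV \<times> vec.span B)"
      proof (rule inj_onI, clarify)
        fix c d :: 'k and x y
        assume x: "x \<in> vec.span B" and y: "y \<in> vec.span B"
          and eq: "c *s b + x = d *s b + y"
        define e where "e = c - d"
        have "e *s b = y - x"
          using eq by (simp add: e_def vec.scale_left_diff_distrib algebra_simps)
        then have "e *s b \<in> vec.span B" using x y by (simp add: vec.span_diff)
        then have "inverse e *s (e *s b) \<in> vec.span B" by (rule vec.span_scale)
        then have "e = 0" using b by (cases "e = 0") simp_all
        then have "c = d" by (simp add: e_def)
        then show "c = d \<and> x = y" using eq by simp
      qed
      show "?f ` (UNIV \<times> vec.span B) = vec.span (insert b B)"
      proof
        show "?f ` (UNIV \<times> vec.span B) \<subseteq> vec.span (insert b B)"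
        proof clarify
          fix c :: 'k and x assume "x \<in> vec.span B"
          then have "x \<in> vec.span (insert b B)"
            using vec.span_mono[OF subset_insertI] by blast
          moreover have "c *s b \<in> vec.span (insert b B)"
            by (simp add: vec.span_base vec.span_scale)
          ultimately show "c *s b + x \<in> vec.span (insert b B)"
            by (simp add: vec.span_add)
        qed
        show "vec.span (insert b B) \<subseteq> ?f ` (UNIV \<times> vec.span B)"
        proof
          fix x assume "x \<in> vec.span (insert b B)"
          then obtain c where "x - c *s b \<in> vec.span B"
            by (auto simp: vec.span_insert)
          then show "x \<in> ?f ` (UNIV \<times> vec.span B)"
            by (intro image_eqI[of _ _ "(c, x - c *s b)"]) auto
        qed
      qed
    qed
    from bij_betw_same_card[OF this] show ?case
      using insert.IH[OF ind] insert.hyps by (simp add: card_cartesian_product)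
  qed
qed

lemma card_subspace:
  fixes S :: "('k::{field,finite} ^ 'n) set"
  assumes "vec.subspace S"
  shows "card S = CARD('k) ^ vec.dim S"
proof -
  obtain B where B: "B \<subseteq> S" "vec.independent B" "S \<subseteq> vec.span B" "card B = vec.dim S"
    using vec.basis_exists by blast
  then have "vec.span B = S"
    using assms vec.span_minimal by blast
  then show ?thesis using card_span_independent[OF B(2)] B(4) by simp
qed

section \<open>Joins of points, and lines through a point\<close>

definition pg_join :: "('k::field ^ 'n) set \<Rightarrow> ('k ^ 'n) set \<Rightarrow> ('k ^ 'n) set" where
  "pg_join P Q = vec.span (P \<union> Q)"

lemma pg_join_upper: "P \<subseteq> pg_join P Q" "Q \<subseteq> pg_join P Q"
  using vec.span_superset unfolding pg_join_def by blast+

text \<open>The dimension formula for sums gives dimension at most 2. If the dimension were at most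
  1, then \<open>P\<close> and \<open>Q\<close>, being one-dimensional subspaces of the join, would
  both equal it.\<close>

lemma pg_join_line:
  assumes P: "P \<in> pg_points" and Q: "Q \<in> pg_points" and "P \<noteq> Q"
  shows "pg_join P Q \<in> pg_lines"
proof -
  have sp: "vec.subspace P" "vec.subspace Q" and d: "vec.dim P = 1" "vec.dim Q = 1"
    using P Q by (auto simp: pg_points_def)
  have sub: "vec.subspace (pg_join P Q)" unfolding pg_join_def by simp
  have "vec.span P = P" "vec.span Q = Q" using sp by simp_all
  then have "pg_join P Q = {x + y |x y. x \<in> P \<and> y \<in> Q}"
    unfolding pg_join_def vec.span_Un by (simp only:)
  then have "vec.dim (pg_join P Q) \<le> 2"
    using vec.dim_sums_Int[OF sp] d by simp
  moreover have "\<not> vec.dim (pg_join P Q) \<le> 1"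
    using vec.subspace_dim_equal[OF sp(1) sub pg_join_upper(1)]
      vec.subspace_dim_equal[OF sp(2) sub pg_join_upper(2)] d \<open>P \<noteq> Q\<close> by auto
  ultimately show ?thesis using sub by (simp add: pg_lines_def)
qed

lemma pg_line_eq_join:
  assumes "P \<in> pg_points" "Q \<in> pg_points" "P \<noteq> Q" "L \<in> pg_lines" "P \<subseteq> L" "Q \<subseteq> L"
  shows "L = pg_join P Q"
proof -
  have L: "vec.subspace L" "vec.dim L = 2"
    using assms by (auto simp: pg_lines_def)
  have J: "vec.subspace (pg_join P Q)" "vec.dim (pg_join P Q) = 2"
    using pg_join_line[OF assms(1-3)] by (auto simp: pg_lines_def)
  have "pg_join P Q \<subseteq> L"
    unfolding pg_join_def using assms L by (intro vec.span_minimal) auto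
  from vec.subspace_dim_equal[OF J(1) L(1) this] show ?thesis using L J by simp
qed

text \<open>Removing \<open>P\<close> from the lines through it leaves pairwise disjoint sets of
  \<open>q^2 - q\<close> vectors, all inside the \<open>q^(N+1) - q\<close> vectors outside
  \<open>P\<close>. The quotient of these two numbers is \<open>theta (N - 1) q\<close>.\<close>

lemma card_lines_through_point:
  fixes P :: "('k::{field,finite} ^ 'n) set" and \<L> :: "('k ^ 'n) set set"
  assumes P: "P \<in> pg_points" and \<L>: "\<L> \<subseteq> pg_lines" and thru: "\<And>L. L \<in> \<L> \<Longrightarrow> P \<subseteq> L"
    and n: "CARD('n) = N + 1" and N: "N \<ge> 1"
  shows "real (card \<L>) \<le> theta (N - 1) CARD('k)"
proof -
  let ?q = "CARD('k)"
  have cP: "card P = ?q"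
    using P card_subspace[of P] by (simp add: pg_points_def)
  have cL: "card L = ?q^2" if "L \<in> \<L>" for L
    using that \<L> card_subspace[of L] by (auto simp: pg_lines_def)
  have "card {0, 1 :: 'k} \<le> ?q" by (rule card_mono) auto
  then have q: "?q \<ge> 2" by simp
  have disj: "(L - P) \<inter> (M - P) = {}" if "L \<in> \<L>" "M \<in> \<L>" "L \<noteq> M" for L M
  proof (rule ccontr)
    assume "(L - P) \<inter> (M - P) \<noteq> {}"
    then obtain x where x: "x \<in> L" "x \<in> M" "x \<notin> P" by blast
    have sub: "vec.subspace L" "vec.subspace M" "vec.subspace P"
      using that \<L> P by (auto simp: pg_lines_def pg_points_def)
    \<comment> \<open>Since \<open>P\<close> contains 0, \<open>x\<close> is nonzero and spans a
      second point common to \<open>L\<close> and \<open>M\<close>. Two distinct common points force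
      the lines to coincide.\<close>
    have "x \<noteq> 0" using x sub vec.subspace_0 by blast
    then have X: "vec.span {x} \<in> pg_points"
      by (simp add: pg_points_def)
    have "x \<in> vec.span {x}" by (simp add: vec.span_base)
    then have ne: "P \<noteq> vec.span {x}" using x by blast
    have "vec.span {x} \<subseteq> L" "vec.span {x} \<subseteq> M"
      by (rule vec.span_minimal; use x sub in simp)+
    then have "L = pg_join P (vec.span {x})" "M = pg_join P (vec.span {x})"
      using that \<L> thru by (intro pg_line_eq_join[OF P X ne]; blast)+
    then show False using \<open>L \<noteq> M\<close> by simp
  qed
  have "card (\<Union>L\<in>\<L>. L - P) = (\<Sum>L\<in>\<L>. card (L - P))"
    using disj by (intro card_UN_disjoint) auto
  also have "\<dots> = (\<Sum>L\<in>\<L>. ?q^2 - ?q)"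
    by (intro sum.cong refl) (simp add: card_Diff_subset thru cL cP)
  also have "\<dots> = card \<L> * (?q^2 - ?q)" by simp
  finally have "card \<L> * (?q^2 - ?q) = card (\<Union>L\<in>\<L>. L - P)" ..
  also have "\<dots> \<le> card (UNIV - P)" by (rule card_mono) auto
  also have "\<dots> = ?q ^ (N + 1) - ?q"
    using card_subspace[of "UNIV :: ('k ^ 'n) set"] cP n
    by (simp add: card_Diff_subset vec.dimension_def[symmetric] vec.dim_UNIV vec_dim_card)
  finally have "real (card \<L> * (?q^2 - ?q)) \<le> real (?q ^ (N + 1) - ?q)"
    by (simp only: of_nat_le_iff)
  then have "real (card \<L>) * (real ?q^2 - real ?q) \<le> real ?q ^ (N + 1) - real ?q"
    using q by (simp add: of_nat_diff power2_eq_square)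
  moreover have "real ?q^2 - real ?q = real ?q * (real ?q - 1)"
    by (simp add: power2_eq_square algebra_simps)
  moreover have "real ?q ^ (N + 1) - real ?q = real ?q * (real ?q ^ N - 1)"
    by (simp add: algebra_simps)
  ultimately have "real ?q * (real (card \<L>) * (real ?q - 1)) \<le> real ?q * (real ?q ^ N - 1)"
    by (simp add: mult_ac)
  then have "real (card \<L>) * (real ?q - 1) \<le> real ?q ^ N - 1"
    using q by (simp add: mult_le_cancel_left_pos del: of_nat_mult)
  then show ?thesis
    using q N by (simp add: theta_def pos_le_divide_eq)
qed

section \<open>Tangents and bisecants of a cap\<close>

lemma is_cap_line_card:
  assumes "is_cap w K" "P \<in> K" "Q \<in> K" "P \<noteq> Q" "L \<in> pg_lines" "P \<subseteq> L" "Q \<subseteq> L"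
  shows "{R \<in> K. R \<subseteq> L} = {P, Q}"
  using assms unfolding is_cap_def pg_collinear_def by blast

text \<open>A second point of \<open>K\<close> on the join would make it a line with exactly two
  points of the cap, and that line would cover \<open>A\<close>.\<close>

lemma join_uncovered_tangent:
  assumes cap: "is_cap w K" and A: "A \<in> uncovered K" and P: "P \<in> K"
  shows "pg_join A P \<in> pg_lines" "{Q \<in> K. Q \<subseteq> pg_join A P} = {P}"
proof -
  have "A \<noteq> P" "A \<in> pg_points" "P \<in> pg_points"
    using assms by (auto simp: uncovered_def covered_def is_cap_def)
  then show L: "pg_join A P \<in> pg_lines" by (simp add: pg_join_line)
  show "{Q \<in> K. Q \<subseteq> pg_join A P} = {P}"
  proof (rule ccontr)
    assume "{Q \<in> K. Q \<subseteq> pg_join A P} \<noteq> {P}"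
    then obtain Q where Q: "Q \<in> K" "Q \<subseteq> pg_join A P" "Q \<noteq> P"
      using P pg_join_upper(2) by blast
    from is_cap_line_card[OF cap P Q(1) Q(3)[symmetric] L pg_join_upper(2) Q(2)]
    have "card {Q \<in> K. Q \<subseteq> pg_join A P} = 2" using Q by simp
    then have "covered K A" using L pg_join_upper(1) unfolding covered_def by blast
    then show False using A by (simp add: uncovered_def)
  qed
qed

text \<open>The leading 1 counts \<open>A\<close> itself. The fibre belonging to \<open>P\<close>
  consists of the uncovered points on the tangent joining \<open>A\<close> to \<open>P\<close>; it
  contains \<open>A\<close>, which is why each summand is reduced by 1.\<close>

lemma newly_covered_ge:
  fixes K :: "('k::{field,finite} ^ 'n) set set"
  assumes cap: "is_cap w K" and A: "A \<in> uncovered K"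
  shows "newly_covered K A
    \<ge> 1 + (\<Sum>P\<in>K. int (card {B \<in> uncovered K. pg_join B P = pg_join A P}) - 1)"
proof -
  let ?U = "uncovered K"
  define S where "S P = {B \<in> ?U. pg_join B P = pg_join A P} - {A}" for P
  have pts: "A \<in> pg_points" "K \<subseteq> pg_points" "?U \<subseteq> pg_points" "A \<notin> K" "?U \<inter> K = {}"
    using A cap by (auto simp: uncovered_def covered_def is_cap_def)
  \<comment> \<open>\<open>covered\<close> asks for exactly two cap points on a line, so
    monotonicity is not automatic. It holds because no bisecant of \<open>K\<close> passes through
    the uncovered point \<open>A\<close>.\<close>
  have mono: "covered (K \<union> {A}) B" if "covered K B" for B
  proof -
    have "{Q \<in> K \<union> {A}. Q \<subseteq> L} = {Q \<in> K. Q \<subseteq> L}"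
      if "L \<in> pg_lines" "card {Q \<in> K. Q \<subseteq> L} = 2" for L
      using A that unfolding uncovered_def covered_def by blast
    then show ?thesis using that unfolding covered_def by auto
  qed
  \<comment> \<open>Adding \<open>A\<close> turns the tangent joining \<open>A\<close> to
    \<open>P\<close> into a line with exactly the two cap points \<open>A\<close> and
    \<open>P\<close>.\<close>
  have new: "covered (K \<union> {A}) B" if P: "P \<in> K" and B: "B \<in> S P" for P B
  proof -
    note L = join_uncovered_tangent[OF cap A P]
    have "{Q \<in> K \<union> {A}. Q \<subseteq> pg_join A P} = {A, P}"
      using L(2) pg_join_upper(1) by blast
    moreover have "A \<noteq> P" using pts P by blast
    ultimately have "card {Q \<in> K \<union> {A}. Q \<subseteq> pg_join A P} = 2" by simp
    moreover have "B \<subseteq> pg_join A P"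
      using B pg_join_upper(1)[of B P] by (simp add: S_def)
    ultimately show ?thesis using L(1) unfolding covered_def by blast
  qed
  \<comment> \<open>A common point \<open>B\<close> would make both tangents equal to the line
    joining \<open>A\<close> and \<open>B\<close>. A single tangent would then meet \<open>K\<close>
    in both \<open>P\<close> and \<open>Q\<close>.\<close>
  have disj: "S P \<inter> S Q = {}" if PQ: "P \<in> K" "Q \<in> K" "P \<noteq> Q" for P Q
  proof (rule ccontr)
    assume "S P \<inter> S Q \<noteq> {}"
    then obtain B where B: "B \<in> ?U" "B \<noteq> A" "pg_join B P = pg_join A P"
      "pg_join B Q = pg_join A Q" by (auto simp: S_def)
    have AB: "A \<in> pg_points" "B \<in> pg_points" "A \<noteq> B"
      using B pts by auto
    have join: "pg_join A R = pg_join A B" if "R \<in> K" "pg_join B R = pg_join A R" for R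
    proof (rule pg_line_eq_join[OF AB])
      show "pg_join A R \<in> pg_lines" by (rule join_uncovered_tangent(1)[OF cap A that(1)])
      show "A \<subseteq> pg_join A R" by (rule pg_join_upper)
      show "B \<subseteq> pg_join A R" using pg_join_upper(1)[of B R] that(2) by simp
    qed
    have "{P} = {R \<in> K. R \<subseteq> pg_join A B}"
      using join_uncovered_tangent(2)[OF cap A PQ(1)] join[OF PQ(1) B(3)] by simp
    also have "\<dots> = {Q}"
      using join_uncovered_tangent(2)[OF cap A PQ(2)] join[OF PQ(2) B(4)] by simp
    finally show False using PQ by simp
  qed
  have sub: "uncovered (K \<union> {A}) \<subseteq> ?U"
    using mono by (auto simp: uncovered_def)
  have "S P \<subseteq> ?U" for P by (auto simp: S_def)
  moreover have "covered (K \<union> {A}) A" by (simp add: covered_def)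
  ultimately have "insert A (\<Union>P\<in>K. S P) \<subseteq> ?U - uncovered (K \<union> {A})"
    using new A unfolding uncovered_def by blast
  then have "card (insert A (\<Union>P\<in>K. S P)) \<le> card (?U - uncovered (K \<union> {A}))"
    by (rule card_mono[rotated]) simp
  also have "int \<dots> = newly_covered K A"
    using sub by (simp add: card_Diff_subset newly_covered_def of_nat_diff card_mono)
  finally have le: "int (card (insert A (\<Union>P\<in>K. S P))) \<le> newly_covered K A" by simp
  have "card (insert A (\<Union>P\<in>K. S P)) = 1 + card (\<Union>P\<in>K. S P)"
    by (subst card_insert_disjoint) (auto simp: S_def)
  also have "card (\<Union>P\<in>K. S P) = (\<Sum>P\<in>K. card (S P))"
    using disj by (intro card_UN_disjoint) auto
  finally have "int (card (insert A (\<Union>P\<in>K. S P))) = 1 + (\<Sum>P\<in>K. int (card (S P)))"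
    by simp
  also have "(\<Sum>P\<in>K. int (card (S P)))
      = (\<Sum>P\<in>K. int (card {B \<in> ?U. pg_join B P = pg_join A P}) - 1)"
  proof (intro sum.cong refl)
    fix P
    have "card {B \<in> ?U. pg_join B P = pg_join A P} = Suc (card (S P))"
      using A unfolding S_def by (intro card.remove) auto
    then show "int (card (S P)) = int (card {B \<in> ?U. pg_join B P = pg_join A P}) - 1"
      by simp
  qed
  finally show ?thesis using le by simp
qed

text \<open>Among the at most \<open>theta (N - 1) q\<close> lines through \<open>P\<close>,
  \<open>w - 1\<close> are taken by the bisecants \<open>?B\<close> to the other points of
  \<open>K\<close>. The tangents \<open>?T\<close> to uncovered points must be found among the
  rest.\<close>

lemma card_tangents_le:
  fixes K :: "('k::{field,finite} ^ 'n) set set"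
  assumes cap: "is_cap w K" and P: "P \<in> K" and n: "CARD('n) = N + 1" and N: "N \<ge> 1"
  shows "real (card ((\<lambda>A. pg_join A P) ` uncovered K)) \<le> theta (N - 1) CARD('k) + 1 - real w"
proof -
  let ?T = "(\<lambda>A. pg_join A P) ` uncovered K" and ?B = "(\<lambda>Q. pg_join Q P) ` (K - {P})"
  have pts: "K \<subseteq> pg_points" and cK: "card K = w" using cap by (auto simp: is_cap_def)
  have lines: "?T \<union> ?B \<subseteq> pg_lines"
  proof (intro Un_least image_subsetI)
    show "pg_join A P \<in> pg_lines" if "A \<in> uncovered K" for A
      by (rule join_uncovered_tangent(1)[OF cap that P])
    show "pg_join Q P \<in> pg_lines" if "Q \<in> K - {P}" for Q
      using that pts P by (intro pg_join_line) auto
  qed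
  \<comment> \<open>The trace of a bisecant on \<open>K\<close> determines \<open>Q\<close>, so
    distinct \<open>Q\<close> give distinct bisecants. It also differs from the trace
    \<open>{P}\<close> of a tangent.\<close>
  have bis: "{R \<in> K. R \<subseteq> pg_join Q P} = {Q, P}" if "Q \<in> K - {P}" for Q
    using that lines by (intro is_cap_line_card[OF cap _ P _ _ pg_join_upper]) auto
  have "inj_on (\<lambda>Q. pg_join Q P) (K - {P})"
  proof (rule inj_onI)
    fix Q R assume QR: "Q \<in> K - {P}" "R \<in> K - {P}" "pg_join Q P = pg_join R P"
    then have "{Q, P} = {R, P}" using bis[of Q] bis[of R] by simp
    then show "Q = R" using QR by (auto simp: doubleton_eq_iff)
  qed
  then have "card ?B = card (K - {P})" by (rule card_image)
  also have "\<dots> = w - 1" using P cK by simp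
  finally have cB: "card ?B = w - 1" .
  have "?T \<inter> ?B = {}"
  proof (rule ccontr)
    assume "?T \<inter> ?B \<noteq> {}"
    then obtain A Q where "A \<in> uncovered K" "Q \<in> K - {P}" "pg_join A P = pg_join Q P" by blast
    then have "{P} = {Q, P}"
      using join_uncovered_tangent(2)[OF cap \<open>A \<in> uncovered K\<close> P] bis[of Q] by simp
    then show False using \<open>Q \<in> K - {P}\<close> by blast
  qed
  then have "card (?T \<union> ?B) = card ?T + (w - 1)"
    by (subst card_Un_disjoint) (auto simp: cB)
  moreover have "real (card (?T \<union> ?B)) \<le> theta (N - 1) CARD('k)"
  proof (rule card_lines_through_point[OF _ lines _ n N])
    show "P \<in> pg_points" using P pts by blast
    show "P \<subseteq> L" if "L \<in> ?T \<union> ?B" for L using that pg_join_upper(2)[of P] by blast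
  qed
  moreover have "w \<ge> 1" using P cK by (metis One_nat_def Suc_leI card_gt_0_iff empty_iff finite)
  ultimately show ?thesis by (simp add: of_nat_diff)
qed

section \<open>Averaging over the uncovered points\<close>

lemma sum_card_fibres_ge:
  assumes "finite X"
  shows "(real (card X))\<^sup>2
    \<le> real (card (f ` X)) * (\<Sum>x\<in>X. real (card {y \<in> X. f y = f x}))"
proof -
  let ?c = "\<lambda>z. real (card {y \<in> X. f y = z})"
  \<comment> \<open>Grouped by the value of \<open>f\<close>, a fibre of size m contributes m
    summands equal to m, hence m^2.\<close>
  have "(\<Sum>x\<in>X. ?c (f x)) = (\<Sum>z\<in>f ` X. \<Sum>x\<in>{x \<in> X. f x = z}. ?c (f x))"
    using assms by (rule sum.image_gen)
  also have "\<dots> = (\<Sum>z\<in>f ` X. (?c z)\<^sup>2)"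
    by (intro sum.cong refl) (simp add: power2_eq_square)
  finally have *: "(\<Sum>x\<in>X. ?c (f x)) = (\<Sum>z\<in>f ` X. (?c z)\<^sup>2)" .
  have "real (card X) = (\<Sum>x\<in>X. 1)" by simp
  also have "\<dots> = (\<Sum>z\<in>f ` X. \<Sum>x\<in>{x \<in> X. f x = z}. 1)"
    using assms by (rule sum.image_gen)
  finally have "real (card X) = (\<Sum>z\<in>f ` X. ?c z)" by simp
  \<comment> \<open>Cauchy--Schwarz for the fibre sizes, whose sum is \<open>card X\<close>.\<close>
  then show ?thesis
    using sum_squared_le_sum_of_squares[of ?c "f ` X"] * by (simp add: mult.commute)
qed

lemma exists_newly_covered_ge_average:
  fixes K :: "('k::{field,finite} ^ 'n) set set"
  assumes cap: "is_cap w K" and w: "w \<ge> 1" and U: "uncovered K \<noteq> {}"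
    and n: "CARD('n) = N + 1" and N: "N \<ge> 1"
  defines "T \<equiv> theta (N - 1) CARD('k) + 1 - real w"
  shows "T > 0"
    and "\<exists>A\<in>uncovered K. real_of_int (newly_covered K A)
           \<ge> real w * real (card (uncovered K)) / T - (real w - 1)"
proof -
  let ?U = "uncovered K"
  define u where "u = real (card ?U)"
  have u: "u > 0" using U by (simp add: u_def card_gt_0_iff)
  have cK: "card K = w" using cap by (simp add: is_cap_def)
  define g where "g P A = real (card {B \<in> ?U. pg_join B P = pg_join A P})" for P A
  \<comment> \<open>An uncovered point yields at least one tangent at each point of
    \<open>K\<close>, so the upper bound \<open>T\<close> on their number must be positive.\<close>
  have t: "0 < real (card ((\<lambda>A. pg_join A P) ` ?U))" for P
    using U by (simp add: card_gt_0_iff)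
  obtain P where "P \<in> K" using w cK by fastforce
  then show T: "T > 0"
    using card_tangents_le[OF cap _ n N] t[of P] unfolding T_def by force
  \<comment> \<open>The fibres of \<open>A \<mapsto> pg_join A P\<close> split the uncovered points
    among at most \<open>T\<close> tangents at \<open>P\<close>.\<close>
  have g: "u\<^sup>2 / T \<le> (\<Sum>A\<in>?U. g P A)" if "P \<in> K" for P
  proof -
    have "u\<^sup>2 \<le> real (card ((\<lambda>A. pg_join A P) ` ?U)) * (\<Sum>A\<in>?U. g P A)"
      unfolding u_def g_def by (rule sum_card_fibres_ge) simp
    also have "\<dots> \<le> T * (\<Sum>A\<in>?U. g P A)"
      using card_tangents_le[OF cap that n N] unfolding T_def g_def
      by (intro mult_right_mono sum_nonneg) auto
    finally show ?thesis using T by (simp add: divide_le_eq mult.commute)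
  qed
  \<comment> \<open>The chain bounds \<open>u\<close> times the claimed average by the total of
    \<open>newly_covered K A\<close> over all uncovered \<open>A\<close>. Exchanging the two sums
    turns the estimates per cap point into estimates per uncovered point.\<close>
  have "u * (real w * u / T - (real w - 1)) = u + real w * (u\<^sup>2 / T - u)"
    using T by (simp add: field_simps power2_eq_square)
  also have "\<dots> = u + (\<Sum>P\<in>K. u\<^sup>2 / T - u)" using cK by simp
  also have "\<dots> \<le> u + (\<Sum>P\<in>K. (\<Sum>A\<in>?U. g P A) - u)"
    using g by (intro add_left_mono sum_mono) auto
  also have "\<dots> = u + (\<Sum>P\<in>K. \<Sum>A\<in>?U. g P A - 1)"
    by (simp add: sum_subtractf u_def)
  also have "\<dots> = (\<Sum>A\<in>?U. 1 + (\<Sum>P\<in>K. g P A - 1))"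
    by (subst sum.swap) (simp add: sum.distrib u_def)
  also have "\<dots> \<le> (\<Sum>A\<in>?U. real_of_int (newly_covered K A))"
  proof (rule sum_mono)
    fix A assume "A \<in> ?U"
    from newly_covered_ge[OF cap this]
    have "real_of_int (1 + (\<Sum>P\<in>K. int (card {B \<in> ?U. pg_join B P = pg_join A P}) - 1))
        \<le> real_of_int (newly_covered K A)" by (simp only: of_int_le_iff)
    then show "1 + (\<Sum>P\<in>K. g P A - 1) \<le> real_of_int (newly_covered K A)"
      by (simp add: g_def)
  qed
  finally have avg: "u * (real w * u / T - (real w - 1))
      \<le> (\<Sum>A\<in>?U. real_of_int (newly_covered K A))" .
  show "\<exists>A\<in>?U. real_of_int (newly_covered K A) \<ge> real w * real (card ?U) / T - (real w - 1)"
  proof (rule ccontr)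
    assume "\<not> ?thesis"
    then have "(\<Sum>A\<in>?U. real_of_int (newly_covered K A))
        < (\<Sum>A\<in>?U. real w * u / T - (real w - 1))"
      using U by (intro sum_strict_mono) (auto simp: u_def not_le)
    then show False using avg by (simp add: u_def)
  qed
qed

theorem corollary6p7:
  fixes N q w U :: nat and D :: real
    and K :: "('k::{field,finite} ^ 'n) set set"
  assumes "N \<ge> 3" and "CARD('n) = N + 1"
    and "primepow q" and "CARD('k) = q"
    and "D \<ge> 1" and "w \<ge> 1" and "U \<ge> 1"
    and "real U \<ge> Phi N w q D \<or> Upsilon N w q D \<ge> real U"
    and "K \<in> caps_with_uncovered w U"
  shows "\<exists>A \<in> uncovered K.
           real_of_int (newly_covered K A)
             \<ge> ((real w * (real q - 1) + 1) * real U) / (D * theta N q)"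
proof -
  have cap: "is_cap w K" and cU: "card (uncovered K) = U"
    using assms by (auto simp: caps_with_uncovered_def)
  have U: "uncovered K \<noteq> {}" using cU \<open>U \<ge> 1\<close> by auto
  have N: "N \<ge> 1" using assms by simp
  have q: "real q > 1" using primepow_gt_Suc_0[OF \<open>primepow q\<close>] by simp
  \<comment> \<open>With these abbreviations the bound to be reached is \<open>c * U / d\<close>,
    \<open>Upsilon\<close> is \<open>d / c\<close>, and \<open>T\<close> bounds the number of
    tangents at a point of \<open>K\<close>.\<close>
  define t where "t = theta (N - 1) q"
  define T where "T = t + 1 - real w"
  define c where "c = real w * (real q - 1) + 1"
  define d where "d = D * theta N q"
  have theta_rec: "theta N q = real q * t + 1"
    using q N by (simp add: theta_def t_def field_simps)
  have T: "T > 0"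
    using exists_newly_covered_ge_average(1)[OF cap \<open>w \<ge> 1\<close> U assms(2) N] assms(4)
    by (simp add: T_def t_def)
  then have "t \<ge> 0" using \<open>w \<ge> 1\<close> by (simp add: T_def)
  then have "theta N q > 0" using q by (simp add: theta_rec add_nonneg_pos)
  then have d: "d > 0" and d_ge: "theta N q \<le> d" using \<open>D \<ge> 1\<close> by (auto simp: d_def)
  have c: "c > 0" using q by (simp add: c_def add_nonneg_pos)
  from assms(8) show ?thesis
  proof
    assume Phi: "real U \<ge> Phi N w q D"
    \<comment> \<open>The denominator of \<open>Phi\<close> must be shown positive before it can be
      cleared. Here \<open>w \<ge> 1\<close> gives both \<open>T \<le> t\<close> and
      \<open>c \<le> w * q\<close>, and \<open>theta N q\<close> exceeds \<open>q * t\<close> by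
      1.\<close>
    have "T * c \<le> t * (real w * real q)"
      using T c q \<open>w \<ge> 1\<close> \<open>t \<ge> 0\<close> by (intro mult_mono) (auto simp: T_def c_def algebra_simps)
    also have "\<dots> < real w * theta N q"
      using \<open>w \<ge> 1\<close> by (simp add: theta_rec algebra_simps)
    also have "\<dots> \<le> real w * d" using d_ge by (rule mult_left_mono) simp
    finally have pos: "real w * d - T * c > 0" by simp
    have "Phi N w q D = (real w - 1) * d * T / (real w * d - T * c)"
      by (simp add: Phi_def d_def T_def c_def t_def mult_ac)
    then have "(real w - 1) * d * T \<le> real U * (real w * d - T * c)"
      using Phi pos by (simp add: divide_le_eq)
    \<comment> \<open>Division by \<open>d * T\<close> shows that the condition on
      \<open>Phi\<close> says exactly that the required bound does not exceed the guaranteed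
      average.\<close>
    then have "c * real U / d \<le> real w * real U / T - (real w - 1)"
      using T d by (simp add: field_simps)
    moreover obtain A where "A \<in> uncovered K"
      "real_of_int (newly_covered K A) \<ge> real w * real U / T - (real w - 1)"
      using exists_newly_covered_ge_average(2)[OF cap \<open>w \<ge> 1\<close> U assms(2) N] assms(4) cU
      by (auto simp: T_def t_def)
    ultimately show ?thesis unfolding c_def d_def by (meson order_trans)
  next
    assume "Upsilon N w q D \<ge> real U"
    \<comment> \<open>Here the required bound is at most 1, so any uncovered \<open>A\<close> will
      do: it always covers itself.\<close>
    then have "c * real U / d \<le> 1"
      using c d by (simp add: Upsilon_def c_def[symmetric] d_def[symmetric] pos_le_divide_eq
          mult.commute)
    moreover obtain A where A: "A \<in> uncovered K" using U by blast
    have "(\<Sum>P\<in>K. int (card {B \<in> uncovered K. pg_join B P = pg_join A P}) - 1) \<ge> 0"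
    proof (rule sum_nonneg)
      fix P
      have "A \<in> {B \<in> uncovered K. pg_join B P = pg_join A P}" using A by simp
      then have "card {B \<in> uncovered K. pg_join B P = pg_join A P} > 0"
        by (subst card_gt_0_iff) auto
      then show "int (card {B \<in> uncovered K. pg_join B P = pg_join A P}) - 1 \<ge> 0" by simp
    qed
    then have "newly_covered K A \<ge> 1" using newly_covered_ge[OF cap A] by simp
    ultimately have "c * real U / d \<le> real_of_int (newly_covered K A)" by linarith
    then show ?thesis using A unfolding c_def d_def by blast
  qed
qed

end
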